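(* For all $d,n\in\mathbb{N}$, the functor $\mathbf{A}_d(n,-):\mathbf{gr}^{op}\to\mathbb{K}\text{-}\mathrm{Mod}$ is polynomial if and only if $n=0$.
   Context: $\mathbb{K}$ is a field of characteristic $0$, $\mathbb{K}\text{-}\mathrm{Mod}$ the category of $\mathbb{K}$-vector spaces, $\mathbb{N}=\{0,1,2,\dots\}$. $\mathbf{gr}$ is the category of finitely generated free groups with objects $n\in\mathbb{N}$ identified with the free group $F_n=\langle x_1,\dots,x_n\rangle$; $\mathbf{gr}(m,n)=\mathrm{Hom}(F_m,F_n)$. Polynomial functors. For $1\le k\le n$ let $i^n_{\hat k}:F_{n-1}\to F_n$ send $x_i\mapsto x_i$ for $i<k$ and $x_i\mapsto x_{i+1}$ for $i\ge k$. A functor $N:\mathbf{gr}^{op}\to\mathbb{K}\text{-}\mathrm{Mod}$ is polynomial of degree at most $e$ if $\ker\big(N(F_{e+1})\to\bigoplus_{k=1}^{e+1}N(F_e)\big)=0$, the map having components $N(i^{e+1}_{\hat k})$; it is polynomial if this holds for some $e\in\mathbb{N}$. Beaded Jacobi diagrams. $X_m$ is the oriented $1$-manifold consisting of $m$ arcs (numbered $1,\dots,m$). A Jacobi diagram $D$ on $X_m$ is a finite uni-trivalent graph with a cyclic order of the half-edges at each trivalent vertex, whose univalent vertices are embedded in the interior of $X_m$, each connected component of $D$ having at least one univalent vertex. Its degree is half its number of vertices. An $F_n$-beaded Jacobi diagram on $X_m$ is a Jacobi diagram on $X_m$ with oriented edges, together with finitely many beads, i.e. points of the interior of $X_m$ or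 of edges of $D$ away from vertices, labelled by elements of $F_n$. Equivalence of beaded diagrams is generated by (up to isomorphism): two consecutive beads $w$ then $x$ (along the orientation of an arc of $X_m$ or an edge) may be replaced by one bead $wx$; a bead $1$ may be removed; reversing the orientation of an edge with one bead $w$ replaces $w$ by $w^{-1}$; a bead $w$ on an arc just before a univalent vertex $v$ may be replaced by a bead $w$ on the arc just after $v$ and a bead $w$ on the edge at $v$, oriented away from $v$ (next to $v$); a bead $w$ on an edge entering a trivalent vertex, the two other edges being oriented outwards, may be replaced by a bead $w$ on each of the two outgoing edges (next to the vertex). $\mathbf{A}(n,m)$ is the $\mathbb{K}$-vector space generated by equivalence classes of $F_n$-beaded Jacobi diagrams on $X_m$ modulo the STU relation: if an unbeaded edge joins a point of an arc to a trivalent vertex with cyclic order (edge to the arc, $b$, $a$), the diagram equals the one where $a,b$ are attached directly to the arc with $a$ just before $b$, minus the one with $b$ just before $a$. $\mathbf{A}_d(n,m)\subset\mathbf{A}(n,m)$ is the subspace generated by diagrams of degree $d$. Functoriality. These are the morphism spaces of the Habiro–Massuyeau linear category $\mathbf{A}$ of Jacobi diagrams in handlebodies, whose degree $0$ part $\mathbf{A}_0$ is isomorphic to the $\mathbb{K}$-linearization of $\mathbf{gr}^{op}$; composition with $\mathbf{A}_0$ makes $\mathbf{A}(n,-)$ a functor on $\mathbf{gr}^{op}$ with subfunctors $\mathbf{A}_d(n,-)$. Explicitly, let $g:F_{m'}\to F_m$ with $g(x_j)=x_{p_{j,1}}^{e_{j,1}}\cdots x_{p_{j,r_j}}^{e_{j,r_j}}$,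 $e_{j,s}=\pm1$. Then $g$ induces $\mathbf{A}(n,m)\to\mathbf{A}(n,m')$ as follows: arc $j$ of $X_{m'}$ is the concatenation, in the order $s=1,\dots,r_j$, of copies of the arcs $p_{j,s}$ of $X_m$ with their beads, the copy being reversed and its beads inverted when $e_{j,s}=-1$; $D$ is sent to the sum, over all ways of attaching each univalent vertex of $D$ lying on an arc $p$ to the corresponding point on one of the copies of the arc $p$, of the resulting diagrams, with sign $(-1)^{r}$, $r$ the number of univalent vertices attached to reversed copies (the sum is $0$ if some arc carrying univalent vertices has no copy). *)

theory Defs
  imports Complex_Main "HOL-Algebra.Module" "HOL-Algebra.RingHom"
    "HOL-Library.Multiset" "HOL-Library.Poly_Mapping" "HOL-Library.Set_Algebras"
begin

section \<open>Finitely generated free groups\<close>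

text \<open>
  Elements of the free group on \<open>n\<close> generators are reduced words. The letter \<open>(i, True)\<close> is the
  generator number \<open>i < n\<close> and \<open>(i, False)\<close> its inverse. Generators of free groups, and arcs
  of the manifold \<open>X_m\<close>, are numbered from 0.
\<close>

type_synonym fword = "(nat \<times> bool) list"

definition flip :: "nat \<times> bool \<Rightarrow> nat \<times> bool" where
  "flip x = (fst x, \<not> snd x)"

definition push :: "nat \<times> bool \<Rightarrow> fword \<Rightarrow> fword" where
  "push x w = (case w of [] \<Rightarrow> [x] | y # ys \<Rightarrow> if y = flip x then ys else x # w)"

definition free_group :: "nat \<Rightarrow> fword monoid" where
  "free_group n =
     \<lparr>carrier = {w. successively (\<lambda>x y. y \<noteq> flip x) w \<and> fst ` set w \<subseteq> {..<n}},
      monoid.mult = (\<lambda>u v. foldr push u v),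
      one = []\<rparr>"

definition word_inv :: "fword \<Rightarrow> fword" where
  "word_inv w = rev (map flip w)"

text \<open>Morphisms \<open>m \<rightarrow> n\<close> of the category \<open>gr\<close>.\<close>

definition gr :: "nat \<Rightarrow> nat \<Rightarrow> (fword \<Rightarrow> fword) set" where
  "gr m n = hom (free_group m) (free_group n)"

text \<open>
  The homomorphism that sends the generator \<open>x_i\<close> to \<open>x_i\<close> for \<open>i < k\<close> and to \<open>x_{i+1}\<close> for
  \<open>i \<ge> k\<close>. Renaming letters injectively preserves reducedness, so it acts letter by letter.
\<close>

definition face :: "nat \<Rightarrow> fword \<Rightarrow> fword" where
  "face k w = map (\<lambda>(i, e). (if i < k then i else Suc i, e)) w"

lemma flip_flip [simp]: "flip (flip x) = x"
  by (simp add: flip_def)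

lemma fst_flip [simp]: "fst (flip x) = fst x"
  by (simp add: flip_def)

lemma flip_neq [simp]: "flip x \<noteq> x" "x \<noteq> flip x"
  by (auto simp: flip_def prod_eq_iff)

lemma push_reduced:
  "successively (\<lambda>x y. y \<noteq> flip x) w \<Longrightarrow> successively (\<lambda>x y. y \<noteq> flip x) (push x w)"
  by (cases w) (auto simp: push_def successively_Cons)

lemma set_push: "set (push x w) \<subseteq> insert x (set w)"
  by (cases w) (auto simp: push_def)

lemma push_flip_push:
  "successively (\<lambda>x y. y \<noteq> flip x) w \<Longrightarrow> push (flip x) (push x w) = w"
  by (cases w) (auto simp: push_def successively_Cons split: list.splits)

lemma push_push_flip:
  "successively (\<lambda>x y. y \<noteq> flip x) w \<Longrightarrow> push x (push (flip x) w) = w"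
  using push_flip_push[of w "flip x"] by simp

lemma foldr_push_reduced:
  "successively (\<lambda>x y. y \<noteq> flip x) v \<Longrightarrow> successively (\<lambda>x y. y \<noteq> flip x) (foldr push u v)"
  by (induction u) (auto intro: push_reduced)

lemma set_foldr_push: "set (foldr push u v) \<subseteq> set u \<union> set v"
  by (induction u) (use set_push in fastforce)+

lemma foldr_push_push:
  assumes "successively (\<lambda>x y. y \<noteq> flip x) w"
  shows "foldr push (push x u) w = push x (foldr push u w)"
proof (cases u)
  case (Cons y ys)
  then show ?thesis
    using push_push_flip[OF foldr_push_reduced[OF assms], of x ys]
    by (auto simp: push_def[of x "y # ys"])
qed (simp add: push_def)

lemma foldr_push_assoc:
  assumes "successively (\<lambda>x y. y \<noteq> flip x) w"
  shows "foldr push (foldr push u v) w = foldr push u (foldr push v w)"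
  by (induction u) (simp_all add: foldr_push_push[OF assms])

lemma foldr_push_Nil:
  "successively (\<lambda>x y. y \<noteq> flip x) u \<Longrightarrow> foldr push u [] = u"
  by (induction u) (auto simp: push_def successively_Cons split: list.splits)

lemma foldr_push_word_inv: "foldr push (word_inv w) w = []"
proof (induction w)
  case (Cons x w)
  have "push (flip x) (x # w) = w"
    by (simp add: push_def)
  with Cons show ?case
    by (simp add: word_inv_def)
qed (simp add: word_inv_def)

lemma word_inv_closed:
  "w \<in> carrier (free_group n) \<Longrightarrow> word_inv w \<in> carrier (free_group n)"
  by (fastforce simp: free_group_def word_inv_def successively_map
        elim: successively_mono)

lemma group_free_group: "group (free_group n)"
proof (rule groupI)
  fix x y
  assume "x \<in> carrier (free_group n)" "y \<in> carrier (free_group n)"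
  then show "x \<otimes>\<^bsub>free_group n\<^esub> y \<in> carrier (free_group n)"
    using set_foldr_push[of x y] by (fastforce simp: free_group_def foldr_push_reduced)
next
  fix x
  assume "x \<in> carrier (free_group n)"
  then show "\<exists>y\<in>carrier (free_group n). y \<otimes>\<^bsub>free_group n\<^esub> x = \<one>\<^bsub>free_group n\<^esub>"
    using word_inv_closed[of x n] foldr_push_word_inv[of x] by (auto simp: free_group_def)
qed (auto simp: free_group_def foldr_push_assoc)

lemma inv_free_group:
  "w \<in> carrier (free_group n) \<Longrightarrow> inv\<^bsub>free_group n\<^esub> w = word_inv w"
  using group.inv_equality[OF group_free_group[of n], of "word_inv w" w] word_inv_closed[of w n]
  by (simp add: free_group_def foldr_push_word_inv)

lemma face_in_gr: "face k \<in> gr n (Suc n)"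
proof -
  let ?f = "\<lambda>(i, e). (if i < k then i else Suc i, e :: bool)"
  have flip_f: "?f y = flip (?f x) \<longleftrightarrow> y = flip x" for x y
    by (cases x; cases y) (auto simp: flip_def split: if_splits)
  have push_f: "face k (push x w) = push (?f x) (face k w)" for x w
    by (cases w) (simp_all add: face_def push_def flip_f del: case_prod_conv split_paired_All)
  have "face k (foldr push u v) = foldr push (face k u) (face k v)" for u v
    by (induction u) (simp_all add: push_f, simp_all add: face_def)
  moreover have "face k w \<in> carrier (free_group (Suc n))" if "w \<in> carrier (free_group n)" for w
    using that
    by (fastforce simp: free_group_def face_def successively_map flip_f split: prod.splits)
  ultimately show ?thesis
    by (auto simp: gr_def hom_def free_group_def)
qed


section \<open>Functors on the opposite of \<open>gr\<close> and polynomiality\<close>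

text \<open>
  The data of a functor from the opposite of \<open>gr\<close> to vector spaces. For \<open>g \<in> gr m' m\<close>, the map
  \<open>arr N m' m g\<close> goes from \<open>obj N m\<close> to \<open>obj N m'\<close>. Vector spaces are HOL-Algebra modules, whose
  fields \<open>mult\<close> and \<open>one\<close> are irrelevant.
\<close>

record ('k, 'v) gr_op_functor =
  obj :: "nat \<Rightarrow> ('k, 'v) module"
  arr :: "nat \<Rightarrow> nat \<Rightarrow> (fword \<Rightarrow> fword) \<Rightarrow> 'v \<Rightarrow> 'v"

text \<open>The kernel of a map into a finite direct sum is the intersection of the kernels of its
  components.\<close>

definition polynomial_of_degree_le :: "('k, 'v) gr_op_functor \<Rightarrow> nat \<Rightarrow> bool" where
  "polynomial_of_degree_le N e \<longleftrightarrow>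
     (\<Inter>k\<in>{..e}. a_kernel (obj N (Suc e)) (obj N e) (arr N e (Suc e) (face k)))
       = {\<zero>\<^bsub>obj N (Suc e)\<^esub>}"

definition is_polynomial :: "('k, 'v) gr_op_functor \<Rightarrow> bool" where
  "is_polynomial N \<longleftrightarrow> (\<exists>e. polynomial_of_degree_le N e)"


section \<open>Beaded Jacobi diagrams\<close>

text \<open>
  The half-edges of a diagram are labelled by natural numbers. An arc is the list, along its
  orientation, of its beads and of the univalent vertices on it, a univalent vertex being given by
  its half-edge. An edge \<open>(s, ws, t)\<close> is oriented from the half-edge \<open>s\<close> to the half-edge \<open>t\<close> and
  carries the beads \<open>ws\<close>, in that order. A trivalent vertex \<open>(a, b, c)\<close> has the half-edges
  \<open>a, b, c\<close> in this cyclic order.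
\<close>

datatype item = Bead fword | Leg nat

datatype diagram = Diagram
  (arcs: "item list list")
  (edges: "(nat \<times> fword list \<times> nat) multiset")
  (triv: "(nat \<times> nat \<times> nat) multiset")

primrec item_legs :: "item \<Rightarrow> nat list" where
  "item_legs (Bead w) = []"
| "item_legs (Leg h) = [h]"

definition legs :: "diagram \<Rightarrow> nat multiset" where
  "legs D = mset (concat (map item_legs (concat (arcs D))))"

definition edge_ends :: "diagram \<Rightarrow> nat multiset" where
  "edge_ends D = (\<Sum>(s, ws, t)\<in>#edges D. {#s, t#})"

definition vertex_ends :: "diagram \<Rightarrow> nat multiset" where
  "vertex_ends D = legs D + (\<Sum>(a, b, c)\<in>#triv D. {#a, b, c#})"

definition adj :: "diagram \<Rightarrow> (nat \<times> nat) set" where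
  "adj D = {(x, y). (\<exists>(s, ws, t)\<in>#edges D. {x, y} \<subseteq> {s, t}) \<or>
                    (\<exists>(a, b, c)\<in>#triv D. {x, y} \<subseteq> {a, b, c})}"

text \<open>
  \<open>F_n\<close>-beaded Jacobi diagrams on \<open>X_m\<close>: every half-edge occurs once at an edge and once at a
  vertex, and every connected component has a univalent vertex.
\<close>

definition diagrams :: "nat \<Rightarrow> nat \<Rightarrow> diagram set" where
  "diagrams n m = {D.
     length (arcs D) = m \<and>
     (\<forall>w. Bead w \<in> set (concat (arcs D)) \<longrightarrow> w \<in> carrier (free_group n)) \<and>
     (\<forall>(s, ws, t)\<in>#edges D. set ws \<subseteq> carrier (free_group n)) \<and>
     edge_ends D = vertex_ends D \<and>
     (\<forall>h. count (edge_ends D) h \<le> 1) \<and>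
     (\<forall>h\<in>#edge_ends D. \<exists>l\<in>#legs D. (h, l) \<in> (adj D)\<^sup>*)}"

definition has_degree :: "diagram \<Rightarrow> nat \<Rightarrow> bool" where
  "has_degree D d \<longleftrightarrow> size (legs D) + size (triv D) = 2 * d"

primrec relabel_item :: "(nat \<Rightarrow> nat) \<Rightarrow> item \<Rightarrow> item" where
  "relabel_item f (Bead w) = Bead w"
| "relabel_item f (Leg h) = Leg (f h)"

definition relabel :: "(nat \<Rightarrow> nat) \<Rightarrow> diagram \<Rightarrow> diagram" where
  "relabel f D = Diagram
     (map (map (relabel_item f)) (arcs D))
     (image_mset (\<lambda>(s, ws, t). (f s, ws, f t)) (edges D))
     (image_mset (\<lambda>(a, b, c). (f a, f b, f c)) (triv D))"

text \<open>
  Adds to the edge that contains the half-edge \<open>h\<close> a bead which is adjacent to \<open>h\<close> and reads \<open>w\<close>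
  in the direction leaving the vertex at \<open>h\<close>. If the edge is oriented towards that vertex, the
  label is therefore \<open>w\<^sup>-\<^sup>1\<close>.
\<close>

definition put_bead ::
    "nat \<Rightarrow> fword \<Rightarrow> nat \<times> fword list \<times> nat \<Rightarrow> nat \<times> fword list \<times> nat" where
  "put_bead h w = (\<lambda>(s, ws, t).
     (s, (if s = h then [w] else []) @ ws @ (if t = h then [word_inv w] else []), t))"

text \<open>
  The first two rules are the isomorphisms. In the last rule the bead \<open>w\<close> enters the
  trivalent vertex along \<open>a\<close> and leaves it along \<open>b\<close> and \<open>c\<close>; with \<open>put_bead\<close> this also covers
  edges that join two of the half-edges \<open>a, b, c\<close>.
\<close>

inductive diagram_move :: "nat \<Rightarrow> diagram \<Rightarrow> diagram \<Rightarrow> bool" for n where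
  relabel: "inj_on f (set_mset (edge_ends D)) \<Longrightarrow> diagram_move n D (relabel f D)"
| rotate: "diagram_move n (Diagram As E (add_mset (a, b, c) T))
                          (Diagram As E (add_mset (b, c, a) T))"
| arc_mult: "diagram_move n
     (Diagram (As @ (us @ Bead w # Bead x # vs) # Bs) E T)
     (Diagram (As @ (us @ Bead (w \<otimes>\<^bsub>free_group n\<^esub> x) # vs) # Bs) E T)"
| arc_one: "diagram_move n
     (Diagram (As @ (us @ Bead \<one>\<^bsub>free_group n\<^esub> # vs) # Bs) E T)
     (Diagram (As @ (us @ vs) # Bs) E T)"
| edge_mult: "diagram_move n
     (Diagram As (add_mset (s, us @ w # x # vs, t) E) T)
     (Diagram As (add_mset (s, us @ (w \<otimes>\<^bsub>free_group n\<^esub> x) # vs, t) E) T)"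
| edge_one: "diagram_move n
     (Diagram As (add_mset (s, us @ \<one>\<^bsub>free_group n\<^esub> # vs, t) E) T)
     (Diagram As (add_mset (s, us @ vs, t) E) T)"
| edge_reverse: "diagram_move n
     (Diagram As (add_mset (s, [w], t) E) T)
     (Diagram As (add_mset (t, [word_inv w], s) E) T)"
| slide_univalent: "diagram_move n
     (Diagram (As @ (us @ Bead w # Leg h # vs) # Bs) E T)
     (Diagram (As @ (us @ Leg h # Bead w # vs) # Bs) (image_mset (put_bead h w) E) T)"
| slide_trivalent: "diagram_move n
     (Diagram As (add_mset (s, ws @ [w], a) E) (add_mset (a, b, c) T))
     (Diagram As (image_mset (put_bead b w \<circ> put_bead c w) (add_mset (s, ws, a) E))
        (add_mset (a, b, c) T))"

definition diagram_equiv :: "nat \<Rightarrow> nat \<Rightarrow> diagram \<Rightarrow> diagram \<Rightarrow> bool" where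
  "diagram_equiv n m =
     equivclp (\<lambda>D D'. D \<in> diagrams n m \<and> D' \<in> diagrams n m \<and> diagram_move n D D')"

text \<open>\<open>stu D D\<^sub>1 D\<^sub>2\<close> stands for the relation \<open>D = D\<^sub>1 - D\<^sub>2\<close>.\<close>

inductive stu :: "diagram \<Rightarrow> diagram \<Rightarrow> diagram \<Rightarrow> bool" where
  "e = (h, [], h') \<or> e = (h', [], h) \<Longrightarrow>
   stu (Diagram (As @ (us @ Leg h # vs) # Bs) (add_mset e E) (add_mset (h', b, a) T))
       (Diagram (As @ (us @ Leg a # Leg b # vs) # Bs) E T)
       (Diagram (As @ (us @ Leg b # Leg a # vs) # Bs) E T)"


section \<open>The spaces of diagrams\<close>

definition pm_scale :: "'k::field \<Rightarrow> ('b \<Rightarrow>\<^sub>0 'k) \<Rightarrow> ('b \<Rightarrow>\<^sub>0 'k)" where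
  "pm_scale c = Poly_Mapping.map ((*) c)"

lemma lookup_pm_scale [simp]:
  "Poly_Mapping.lookup (pm_scale c v) x = c * Poly_Mapping.lookup v x"
  by (simp add: pm_scale_def Poly_Mapping.map.rep_eq when_def)

interpretation pm: vector_space "pm_scale :: 'k::field \<Rightarrow> ('b \<Rightarrow>\<^sub>0 'k) \<Rightarrow> ('b \<Rightarrow>\<^sub>0 'k)"
  by standard (auto intro!: poly_mapping_eqI simp: lookup_add algebra_simps)

abbreviation basis_vec :: "'b \<Rightarrow> ('b \<Rightarrow>\<^sub>0 'k::field)" where
  "basis_vec D \<equiv> Poly_Mapping.single D 1"

text \<open>
  The space generated by equivalence classes of diagrams modulo STU, presented as the quotient of
  the free vector space on diagrams by both kinds of relations.
\<close>

definition relations :: "nat \<Rightarrow> nat \<Rightarrow> (diagram \<Rightarrow>\<^sub>0 'k::field) set" where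
  "relations n m = pm.span
     ({basis_vec D - basis_vec D' | D D'.
         D \<in> diagrams n m \<and> D' \<in> diagrams n m \<and> diagram_equiv n m D D'} \<union>
      {basis_vec D - (basis_vec D\<^sub>1 - basis_vec D\<^sub>2) | D D\<^sub>1 D\<^sub>2. D \<in> diagrams n m \<and> stu D D\<^sub>1 D\<^sub>2})"

text \<open>Vectors of the quotient are cosets.\<close>

definition jacobi_space :: "nat \<Rightarrow> nat \<Rightarrow> ('k::field, (diagram \<Rightarrow>\<^sub>0 'k) set) module" where
  "jacobi_space n m =
     \<lparr>carrier = (\<lambda>v. v +o relations n m) ` pm.span (basis_vec ` diagrams n m),
      monoid.mult = undefined,
      one = undefined,
      zero = relations n m,
      add = (+),
      smult = (\<lambda>c X. pm_scale c ` X + relations n m)\<rparr>"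

definition jacobi_space_deg ::
    "nat \<Rightarrow> nat \<Rightarrow> nat \<Rightarrow> ('k::field, (diagram \<Rightarrow>\<^sub>0 'k) set) module" where
  "jacobi_space_deg d n m = (jacobi_space n m)
     \<lparr>carrier := (\<lambda>v. v +o relations n m) ` pm.span (basis_vec ` {D \<in> diagrams n m. has_degree D d})\<rparr>"


section \<open>Functoriality\<close>

text \<open>
  Let \<open>g \<in> gr m' m\<close>. In all of the following, \<open>gen_word g j\<close> is the reduced word of the image of the
  generator \<open>x_j\<close>, and \<open>(j, s)\<close> with \<open>s < length (gen_word g j)\<close> stands for the copy of an arc of
  \<open>X_m\<close> which is the \<open>s\<close>-th piece of arc \<open>j\<close> of \<open>X_m'\<close>.
\<close>

definition gen_word :: "(fword \<Rightarrow> fword) \<Rightarrow> nat \<Rightarrow> fword" where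
  "gen_word g j = g [(j, True)]"

definition copies :: "(fword \<Rightarrow> fword) \<Rightarrow> nat \<Rightarrow> nat \<Rightarrow> (nat \<times> nat) set" where
  "copies g m' p =
     {(j, s). j < m' \<and> s < length (gen_word g j) \<and> fst (gen_word g j ! s) = p}"

definition attachments :: "(fword \<Rightarrow> fword) \<Rightarrow> nat \<Rightarrow> diagram \<Rightarrow> (nat \<Rightarrow> nat \<times> nat) set" where
  "attachments g m' D =
     {\<phi> \<in> extensional (set_mset (legs D)).
        \<forall>p < length (arcs D). \<forall>h. Leg h \<in> set (arcs D ! p) \<longrightarrow> \<phi> h \<in> copies g m' p}"

primrec on_copy :: "(nat \<Rightarrow> nat \<times> nat) \<Rightarrow> nat \<times> nat \<Rightarrow> item \<Rightarrow> bool" where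
  "on_copy \<phi> q (Bead w) = True"
| "on_copy \<phi> q (Leg h) = (\<phi> h = q)"

primrec invert_item :: "item \<Rightarrow> item" where
  "invert_item (Bead w) = Bead (word_inv w)"
| "invert_item (Leg h) = Leg h"

definition arc_copy ::
    "(nat \<Rightarrow> nat \<times> nat) \<Rightarrow> nat \<times> nat \<Rightarrow> bool \<Rightarrow> item list \<Rightarrow> item list" where
  "arc_copy \<phi> q e xs =
     (let ys = filter (on_copy \<phi> q) xs in if e then ys else rev (map invert_item ys))"

definition attach ::
    "(fword \<Rightarrow> fword) \<Rightarrow> nat \<Rightarrow> (nat \<Rightarrow> nat \<times> nat) \<Rightarrow> diagram \<Rightarrow> diagram" where
  "attach g m' \<phi> D = Diagram
     (map (\<lambda>j. concat (map (\<lambda>s. case gen_word g j ! s of (p, e) \<Rightarrow> arc_copy \<phi> (j, s) e (arcs D ! p))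
                            [0..<length (gen_word g j)]))
          [0..<m'])
     (edges D) (triv D)"

definition reversed_legs :: "(fword \<Rightarrow> fword) \<Rightarrow> (nat \<Rightarrow> nat \<times> nat) \<Rightarrow> diagram \<Rightarrow> nat set" where
  "reversed_legs g \<phi> D = {h. h \<in># legs D \<and> (case \<phi> h of (j, s) \<Rightarrow> \<not> snd (gen_word g j ! s))}"

definition diagram_action ::
    "(fword \<Rightarrow> fword) \<Rightarrow> nat \<Rightarrow> diagram \<Rightarrow> (diagram \<Rightarrow>\<^sub>0 'k::field)" where
  "diagram_action g m' D =
     (\<Sum>\<phi>\<in>attachments g m' D.
        pm_scale ((-1) ^ card (reversed_legs g \<phi> D)) (basis_vec (attach g m' \<phi> D)))"

definition linear_action ::
    "(fword \<Rightarrow> fword) \<Rightarrow> nat \<Rightarrow> (diagram \<Rightarrow>\<^sub>0 'k::field) \<Rightarrow> (diagram \<Rightarrow>\<^sub>0 'k)" where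
  "linear_action g m' v =
     (\<Sum>D\<in>Poly_Mapping.keys v. pm_scale (Poly_Mapping.lookup v D) (diagram_action g m' D))"

text \<open>The map induced on cosets is the one whose value contains the images of all
  representatives.\<close>

definition jacobi_functor ::
    "nat \<Rightarrow> nat \<Rightarrow> ('k::field, (diagram \<Rightarrow>\<^sub>0 'k) set) gr_op_functor" where
  "jacobi_functor d n =
     \<lparr>obj = jacobi_space_deg d n,
      arr = (\<lambda>m' m g X. \<Union>v\<in>X. linear_action g m' v +o relations n m')\<rparr>"

end

theory Submission
  imports Defs
begin

text \<open>
  The face \<open>k\<close> acts on a diagram by deleting the arc \<open>k\<close> if this arc carries no univalent vertices
  (legs), and by zero otherwise (\<open>diagram_action_face\<close>). The degree of polynomiality is therefore
  governed by what a diagram can carry on its arcs: legs, of which there are at most \<open>2 * d\<close> in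
  degree \<open>d\<close>, and beads, of which there may be any number.

  If \<open>n = 0\<close>, all beads are trivial. Call an arc occupied if it carries legs. The set of occupied
  arcs is the same for all terms of any relation, so the space of diagrams is graded by it. On the
  part where the arc \<open>k\<close> is not occupied, the face \<open>k\<close> is injective, since an empty arc can be put
  back. On \<open>2 * d + 1\<close> arcs, every diagram of degree \<open>d\<close> leaves an arc unoccupied. So a vector killed by
  all faces vanishes in every part, and the functor is polynomial of degree at most \<open>2 * d\<close>
  (\<open>polynomial_without_beads\<close>).

  If \<open>n > 0\<close>, put \<open>d\<close> chords on the arc 0 and, for each set \<open>S\<close> of arcs, a bead \<open>x_0\<close> on each arc in
  \<open>S\<close>. The alternating sum of these diagrams over all \<open>S\<close> is killed by each face: either the face
  meets the legs on the arc 0, or it deletes an arc and makes the terms for \<open>S\<close> and \<open>insert k S\<close>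
  cancel. The sum is not zero because of the following invariant of diagrams: the list of the
  products of beads along the arcs, for diagrams without trivalent vertices, and zero for the others
  (\<open>weight_relations\<close>). As the number of arcs is arbitrary, the functor is not polynomial
  (\<open>not_polynomial_with_beads\<close>).
\<close>


section \<open>Linear extension of maps on generators\<close>

definition lin_ext :: "('a \<Rightarrow> ('b \<Rightarrow>\<^sub>0 'k::field)) \<Rightarrow> ('a \<Rightarrow>\<^sub>0 'k) \<Rightarrow> ('b \<Rightarrow>\<^sub>0 'k)" where
  "lin_ext F v = (\<Sum>x\<in>Poly_Mapping.keys v. pm_scale (Poly_Mapping.lookup v x) (F x))"

lemma lin_ext_superset:
  assumes "finite A" "Poly_Mapping.keys v \<subseteq> A"
  shows "lin_ext F v = (\<Sum>x\<in>A. pm_scale (Poly_Mapping.lookup v x) (F x))"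
  unfolding lin_ext_def
  by (rule sum.mono_neutral_left) (use assms in \<open>auto simp: in_keys_iff\<close>)

lemma lin_ext_0 [simp]: "lin_ext F 0 = 0"
  by (simp add: lin_ext_def)

lemma lin_ext_add: "lin_ext F (u + v) = lin_ext F u + lin_ext F v"
proof -
  let ?A = "Poly_Mapping.keys u \<union> Poly_Mapping.keys v"
  have "Poly_Mapping.keys (u + v) \<subseteq> ?A"
    by (rule Poly_Mapping.keys_add)
  then show ?thesis
    by (simp add: lin_ext_superset[of ?A] lookup_add pm.scale_left_distrib sum.distrib)
qed

lemma lin_ext_scale: "lin_ext F (pm_scale c v) = pm_scale c (lin_ext F v)"
proof -
  have "Poly_Mapping.keys (pm_scale c v) \<subseteq> Poly_Mapping.keys v"
    by (auto simp: in_keys_iff)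
  then show ?thesis
    by (simp add: lin_ext_superset[of "Poly_Mapping.keys v"] pm.scale_sum_right)
qed

lemma lin_ext_diff: "lin_ext F (u - v) = lin_ext F u - lin_ext F v"
  using lin_ext_add[of F "u - v" v] by simp

lemma lin_ext_sum: "lin_ext F (\<Sum>i\<in>I. v i) = (\<Sum>i\<in>I. lin_ext F (v i))"
  by (induction I rule: infinite_finite_induct) (simp_all add: lin_ext_add)

lemma lin_ext_basis [simp]: "lin_ext F (basis_vec x) = F x"
  by (simp add: lin_ext_def)

lemma lin_ext_cong:
  "(\<And>x. x \<in> Poly_Mapping.keys v \<Longrightarrow> F x = G x) \<Longrightarrow> lin_ext F v = lin_ext G v"
  by (simp add: lin_ext_def)

lemma lin_ext_lin_ext: "lin_ext G (lin_ext F v) = lin_ext (\<lambda>x. lin_ext G (F x)) v"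
  by (simp add: lin_ext_def[of F] lin_ext_sum lin_ext_scale) (simp add: lin_ext_def)

lemma lin_ext_diff_fun: "lin_ext (\<lambda>x. F x - G x) v = lin_ext F v - lin_ext G v"
  by (simp add: lin_ext_def pm.scale_right_diff_distrib sum_subtractf)

lemma lin_ext_sum_fun: "lin_ext (\<lambda>x. \<Sum>i\<in>I. F i x) v = (\<Sum>i\<in>I. lin_ext (F i) v)"
  unfolding lin_ext_def by (simp add: pm.scale_sum_right) (rule sum.swap)

lemma lin_ext_basis_vec: "lin_ext basis_vec v = v"
proof (rule poly_mapping_eqI)
  fix k
  have "Poly_Mapping.lookup (lin_ext basis_vec v) k =
      (\<Sum>x\<in>Poly_Mapping.keys v. if x = k then Poly_Mapping.lookup v x else 0)"
    unfolding lin_ext_def lookup_sum by (rule sum.cong) (auto simp: lookup_single)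
  then show "Poly_Mapping.lookup (lin_ext basis_vec v) k = Poly_Mapping.lookup v k"
    by (simp add: in_keys_iff)
qed

lemma lin_ext_in_subspace:
  "pm.subspace W \<Longrightarrow> (\<And>x. x \<in> Poly_Mapping.keys v \<Longrightarrow> F x \<in> W) \<Longrightarrow> lin_ext F v \<in> W"
  unfolding lin_ext_def by (intro pm.subspace_sum pm.subspace_scale)

lemma keys_of_span_basis:
  "v \<in> pm.span (basis_vec ` A) \<Longrightarrow> Poly_Mapping.keys (v :: 'b \<Rightarrow>\<^sub>0 'k::field) \<subseteq> A"
proof (induction rule: pm.span_induct_alt)
  case base
  then show ?case by simp
next
  case (step c x y)
  have "Poly_Mapping.keys (pm_scale c x) \<subseteq> A"
    using step(1) by (auto simp: in_keys_iff lookup_single when_def split: if_splits)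
  then show ?case
    using step(2) Poly_Mapping.keys_add[of "pm_scale c x" y] by blast
qed

lemma linear_action_eq: "linear_action g m = lin_ext (diagram_action g m)"
  by (rule ext) (simp add: linear_action_def lin_ext_def)


section \<open>Maps out of the space of diagrams\<close>

lemma subspace_relations [intro]: "pm.subspace (relations n m)"
  by (simp add: relations_def)

lemma zero_in_relations: "0 \<in> relations n m"
  by (rule pm.subspace_0[OF subspace_relations])

lemma relations_moveI:
  assumes "D \<in> diagrams n m" "D' \<in> diagrams n m" "D = D' \<or> diagram_move n D D'"
  shows "basis_vec D - basis_vec D' \<in> relations n m"
proof (cases "D = D'")
  case True
  then show ?thesis by (simp add: zero_in_relations)
next
  case False
  with assms have "diagram_equiv n m D D'"
    by (auto simp: diagram_equiv_def)
  then show ?thesis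
    unfolding relations_def using assms by (intro pm.span_base) blast
qed

lemma relations_stuI:
  assumes "D \<in> diagrams n m" "stu D D\<^sub>1 D\<^sub>2"
  shows "basis_vec D - (basis_vec D\<^sub>1 - basis_vec D\<^sub>2) \<in> relations n m"
  unfolding relations_def using assms by (intro pm.span_base) blast

text \<open>
  Equivalence of diagrams is generated by moves between diagrams, so compatibility of a linear map
  with the relations need only be checked on single moves and on STU. Every map that is shown below
  to be well defined on spaces of diagrams is treated by this criterion.
\<close>

lemma lin_ext_relations:
  assumes v: "v \<in> relations n m" and W: "pm.subspace W"
    and move: "\<And>D D'. D \<in> diagrams n m \<Longrightarrow> D' \<in> diagrams n m \<Longrightarrow> diagram_move n D D' \<Longrightarrow>
      F D - F D' \<in> W"
    and stu: "\<And>D D\<^sub>1 D\<^sub>2. D \<in> diagrams n m \<Longrightarrow> stu D D\<^sub>1 D\<^sub>2 \<Longrightarrow> F D - (F D\<^sub>1 - F D\<^sub>2) \<in> W"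
  shows "lin_ext F v \<in> W"
proof -
  have equiv: "F D - F D' \<in> W" if "diagram_equiv n m D D'" for D D'
    using that unfolding diagram_equiv_def
  proof (induction rule: equivclp_induct)
    case base
    then show ?case by (simp add: pm.subspace_0[OF W])
  next
    case (step y z)
    have "F y - F z \<in> W"
      using step(2) move pm.subspace_neg[OF W, of "F z - F y"] by auto
    then show ?case
      using pm.subspace_add[OF W step(3)] by fastforce
  qed
  show ?thesis
    using v unfolding relations_def
  proof (induction rule: pm.span_induct_alt)
    case base
    then show ?case by (simp add: pm.subspace_0[OF W])
  next
    case (step c x y)
    then have "lin_ext F x \<in> W"
      by (auto simp: lin_ext_diff intro: equiv stu)
    with step W show ?case
      by (simp add: lin_ext_add lin_ext_scale pm.subspace_add pm.subspace_scale)
  qed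
qed


section \<open>Deleting and inserting arcs\<close>

definition map_arcs :: "(item list list \<Rightarrow> item list list) \<Rightarrow> diagram \<Rightarrow> diagram" where
  "map_arcs \<tau> D = Diagram (\<tau> (arcs D)) (edges D) (triv D)"

definition has_legs :: "item list \<Rightarrow> bool" where
  "has_legs xs \<longleftrightarrow> (\<exists>h. Leg h \<in> set xs)"

lemma has_legs_simps [simp]:
  "\<not> has_legs []" "has_legs (Leg h # xs)" "has_legs (Bead w # xs) = has_legs xs"
  "has_legs (xs @ ys) = (has_legs xs \<or> has_legs ys)"
  by (auto simp: has_legs_def)

lemma has_legs_relabel [simp]: "has_legs (map (relabel_item f) xs) = has_legs xs"
proof (induction xs)
  case (Cons x xs)
  then show ?case by (cases x) simp_all
qed simp

text \<open>
  All relations preserve the set of occupied arcs: moves do not transport a leg to another arc,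
  and the STU relation replaces one leg by two on the same arc.
\<close>

definition occupancy :: "diagram \<Rightarrow> bool list" where
  "occupancy D = map has_legs (arcs D)"

lemma occupancy_move: "diagram_move n D D' \<Longrightarrow> occupancy D = occupancy D'"
  by (induction rule: diagram_move.induct) (auto simp: occupancy_def relabel_def)

lemma occupancy_stu: "stu D D\<^sub>1 D\<^sub>2 \<Longrightarrow> occupancy D\<^sub>1 = occupancy D \<and> occupancy D\<^sub>2 = occupancy D"
  by (induction rule: stu.induct) (auto simp: occupancy_def)

text \<open>
  An operation \<open>\<tau>\<close> on lists of arcs is local at position \<open>p\<close> if it keeps the arc at \<open>p\<close>, whatever
  that arc carries, and treats the other arcs independently of it. It is blind at \<open>p\<close> if
  it forgets what that arc carries. Inserting an arc is local everywhere; deleting the arc \<open>k\<close>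
  is blind at \<open>k\<close> and local elsewhere.
\<close>

definition local_at :: "(item list list \<Rightarrow> item list list) \<Rightarrow> nat \<Rightarrow> bool" where
  "local_at \<tau> p \<longleftrightarrow>
     (\<forall>As Bs. length As = p \<longrightarrow> (\<exists>As' Bs'. \<forall>xs. \<tau> (As @ xs # Bs) = As' @ xs # Bs'))"

definition blind_at :: "(item list list \<Rightarrow> item list list) \<Rightarrow> nat \<Rightarrow> bool" where
  "blind_at \<tau> p \<longleftrightarrow>
     (\<forall>As Bs xs ys. length As = p \<longrightarrow> \<tau> (As @ xs # Bs) = \<tau> (As @ ys # Bs))"

text \<open>
  A move changes the content of at most one arc, up to renaming of half-edges. If \<open>\<tau>\<close> is local
  there, the same move can be performed after \<open>\<tau>\<close>. If \<open>\<tau>\<close> is blind there, the move becomes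
  invisible, provided that it affects nothing but this arc. Apart from renamings, the only move that
  changes both an arc and the edges is the sliding of a bead past a leg, and it is excluded on an arc without legs.
\<close>

lemma diagram_move_map_arcs:
  assumes "diagram_move n D D'"
    and nat: "\<And>f xss. \<tau> (map (map f) xss) = map (map f) (\<tau> xss)"
    and loc: "\<And>p. p < length (occupancy D) \<Longrightarrow> local_at \<tau> p \<or> \<not> occupancy D ! p \<and> blind_at \<tau> p"
  shows "map_arcs \<tau> D = map_arcs \<tau> D' \<or> diagram_move n (map_arcs \<tau> D) (map_arcs \<tau> D')"
proof -
  have change: "(\<exists>As' Bs'. \<forall>ys. \<tau> (As @ ys # Bs) = As' @ ys # Bs') \<or>
      \<not> has_legs xs \<and> (\<forall>xs ys. \<tau> (As @ xs # Bs) = \<tau> (As @ ys # Bs))"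
    if "arcs D = As @ xs # Bs" for As xs Bs
    using loc[of "length As"] that
    by (auto simp: occupancy_def local_at_def blind_at_def nth_append)
  from assms(1) change show ?thesis
  proof (cases rule: diagram_move.cases)
    case (relabel f)
    have "diagram_move n (map_arcs \<tau> D) (Defs.relabel f (map_arcs \<tau> D))"
      using relabel by (intro diagram_move.relabel) (simp add: map_arcs_def edge_ends_def)
    then show ?thesis
      using relabel by (simp add: map_arcs_def relabel_def nat)
  next
    case (arc_mult As us w x vs Bs E T)
    then have "arcs D = As @ (us @ Bead w # Bead x # vs) # Bs"
      by simp
    from change[OF this] show ?thesis
      unfolding arc_mult(1,2)
      by (elim disjE exE conjE) (simp_all add: map_arcs_def diagram_move.arc_mult)
  next
    case (arc_one As us vs Bs E T)
    then have "arcs D = As @ (us @ Bead \<one>\<^bsub>free_group n\<^esub> # vs) # Bs"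
      by simp
    from change[OF this] show ?thesis
      unfolding arc_one(1,2)
      by (elim disjE exE conjE) (simp_all add: map_arcs_def diagram_move.arc_one)
  next
    case (slide_univalent As us w h vs Bs E T)
    then have "arcs D = As @ (us @ Bead w # Leg h # vs) # Bs"
      by simp
    from change[OF this] show ?thesis
      unfolding slide_univalent(1,2)
      by (elim disjE exE conjE) (simp_all add: map_arcs_def diagram_move.slide_univalent)
  next
    case (slide_trivalent As s ws w a E b c T)
    show ?thesis
      unfolding slide_trivalent(1,2) map_arcs_def diagram.sel
      by (intro disjI2 diagram_move.slide_trivalent)
  qed (auto simp: map_arcs_def intro: diagram_move.intros)
qed

lemma stu_map_arcs:
  assumes "stu D D\<^sub>1 D\<^sub>2"
    and loc: "\<And>p. p < length (occupancy D) \<Longrightarrow> occupancy D ! p \<Longrightarrow> local_at \<tau> p"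
  shows "stu (map_arcs \<tau> D) (map_arcs \<tau> D\<^sub>1) (map_arcs \<tau> D\<^sub>2)"
  using assms(1)
proof (cases rule: stu.cases)
  case (1 e h h' As us vs Bs E b a T)
  then have "local_at \<tau> (length As)"
    by (intro loc) (simp_all add: occupancy_def nth_append)
  then obtain As' Bs' where "\<And>ys. \<tau> (As @ ys # Bs) = As' @ ys # Bs'"
    unfolding local_at_def by metis
  with 1 show ?thesis
    by (auto simp: map_arcs_def intro: stu.intros)
qed

lemma map_arcs_in_diagrams:
  assumes "D \<in> diagrams n m" "length (\<tau> (arcs D)) = m'"
    "set (concat (\<tau> (arcs D))) \<subseteq> set (concat (arcs D))" "legs (map_arcs \<tau> D) = legs D"
  shows "map_arcs \<tau> D \<in> diagrams n m'"
proof -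
  have "edge_ends (map_arcs \<tau> D) = edge_ends D" "vertex_ends (map_arcs \<tau> D) = vertex_ends D"
    "adj (map_arcs \<tau> D) = adj D"
    using assms(4) by (simp_all add: edge_ends_def vertex_ends_def adj_def map_arcs_def)
  then show ?thesis
    using assms unfolding diagrams_def by (auto simp: map_arcs_def)
qed

definition remove_nth :: "nat \<Rightarrow> 'a list \<Rightarrow> 'a list" where
  "remove_nth k xs = take k xs @ drop (Suc k) xs"

definition insert_nil :: "nat \<Rightarrow> item list list \<Rightarrow> item list list" where
  "insert_nil k xss = take k xss @ [] # drop k xss"

lemma local_at_remove_nth: "p \<noteq> k \<Longrightarrow> local_at (remove_nth k) p"
  unfolding local_at_def
proof (intro allI impI)
  fix As Bs :: "item list list"
  assume neq: "p \<noteq> k" and p: "length As = p"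
  show "\<exists>As' Bs'. \<forall>xs. remove_nth k (As @ xs # Bs) = As' @ xs # Bs'"
  proof (cases "k < p")
    case True
    with p have "\<forall>xs. remove_nth k (As @ xs # Bs) = remove_nth k As @ xs # Bs"
      by (simp add: remove_nth_def)
    then show ?thesis by blast
  next
    case False
    with neq obtain i where "k = p + Suc i"
      by (metis less_imp_Suc_add nat_neq_iff add_Suc_right)
    with p have "\<forall>xs. remove_nth k (As @ xs # Bs) = As @ xs # remove_nth i Bs"
      by (simp add: remove_nth_def)
    then show ?thesis by blast
  qed
qed

lemma blind_at_remove_nth: "blind_at (remove_nth k) k"
  by (auto simp: blind_at_def remove_nth_def)

lemma local_at_insert_nil: "local_at (insert_nil k) p"
  unfolding local_at_def
proof (intro allI impI)
  fix As Bs :: "item list list"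
  assume p: "length As = p"
  show "\<exists>As' Bs'. \<forall>xs. insert_nil k (As @ xs # Bs) = As' @ xs # Bs'"
  proof (cases "k \<le> p")
    case True
    with p have "\<forall>xs. insert_nil k (As @ xs # Bs) = insert_nil k As @ xs # Bs"
      by (simp add: insert_nil_def)
    then show ?thesis by blast
  next
    case False
    then obtain i where "k = p + Suc i"
      by (metis less_imp_Suc_add not_le_imp_less add_Suc_right)
    with p have "\<forall>xs. insert_nil k (As @ xs # Bs) = As @ xs # insert_nil i Bs"
      by (simp add: insert_nil_def)
    then show ?thesis by blast
  qed
qed

lemma item_legs_Nil: "\<not> has_legs xs \<Longrightarrow> concat (map item_legs xs) = []"
proof (induction xs)
  case (Cons x xs)
  then show ?case by (cases x) auto
qed simp

definition delete_arc :: "nat \<Rightarrow> diagram \<Rightarrow> diagram" where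
  "delete_arc k = map_arcs (remove_nth k)"

definition insert_arc :: "nat \<Rightarrow> diagram \<Rightarrow> diagram" where
  "insert_arc k = map_arcs (insert_nil k)"

lemma delete_arc_in_diagrams:
  assumes D: "D \<in> diagrams n (Suc m)" and k: "k \<le> m" "\<not> occupancy D ! k"
  shows "delete_arc k D \<in> diagrams n m"
proof -
  have len: "length (arcs D) = Suc m"
    using D by (simp add: diagrams_def)
  with k have split: "arcs D = take k (arcs D) @ arcs D ! k # drop (Suc k) (arcs D)"
    by (simp add: id_take_nth_drop)
  have "\<not> has_legs (arcs D ! k)"
    using k len by (simp add: occupancy_def)
  then have "concat (map item_legs (concat (arcs D))) =
      concat (map item_legs (concat (remove_nth k (arcs D))))"
    by (subst split) (simp add: remove_nth_def item_legs_Nil)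
  moreover have "set (concat (remove_nth k (arcs D))) \<subseteq> set (concat (arcs D))"
    by (auto simp: remove_nth_def dest: in_set_takeD in_set_dropD)
  ultimately show ?thesis
    unfolding delete_arc_def using len k
    by (intro map_arcs_in_diagrams[OF D]) (simp_all add: remove_nth_def legs_def map_arcs_def)
qed

lemma insert_arc_in_diagrams:
  assumes D: "D \<in> diagrams n m" and k: "k \<le> m"
  shows "insert_arc k D \<in> diagrams n (Suc m)"
proof -
  have "concat (insert_nil k (arcs D)) = concat (arcs D)"
    by (metis append_Nil append_take_drop_id concat.simps(2) concat_append insert_nil_def)
  then show ?thesis
    unfolding insert_arc_def using D k
    by (intro map_arcs_in_diagrams[OF D])
       (simp_all add: insert_nil_def legs_def map_arcs_def diagrams_def)
qed


section \<open>Faces act by deleting arcs\<close>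

definition distinct_legs :: "diagram \<Rightarrow> bool" where
  "distinct_legs D \<longleftrightarrow> (\<forall>h. count (legs D) h \<le> 1)"

lemma distinct_legs_diagrams: "D \<in> diagrams n m \<Longrightarrow> distinct_legs D"
  unfolding distinct_legs_def
proof
  fix h
  assume "D \<in> diagrams n m"
  then have "count (vertex_ends D) h \<le> 1"
    by (auto simp: diagrams_def)
  then show "count (legs D) h \<le> 1"
    by (simp add: vertex_ends_def)
qed

text \<open>
  Only the left-hand side of an STU relation is required to be a diagram. The formula for the action
  of a face has to be applied to the right-hand sides too; for this it is enough that no leg occurs
  twice.
\<close>

lemma distinct_legs_stu:
  assumes D: "D \<in> diagrams n m" and "stu D D\<^sub>1 D\<^sub>2"
  shows "distinct_legs D\<^sub>1" "distinct_legs D\<^sub>2"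
proof -
  have "count (legs D\<^sub>1) x \<le> count (vertex_ends D) x \<and> count (legs D\<^sub>2) x \<le> count (vertex_ends D) x"
    for x
    using assms(2) by (cases rule: stu.cases) (auto simp: vertex_ends_def legs_def)
  moreover have "count (vertex_ends D) x \<le> 1" for x
    using D by (auto simp: diagrams_def)
  ultimately show "distinct_legs D\<^sub>1" "distinct_legs D\<^sub>2"
    unfolding distinct_legs_def using order_trans by blast+
qed

lemma Leg_in_set_iff: "Leg h \<in> set xs \<longleftrightarrow> h \<in> set (concat (map item_legs xs))"
proof (induction xs)
  case (Cons x xs)
  then show ?case by (cases x) auto
qed simp

lemma in_legs_iff: "h \<in># legs D \<longleftrightarrow> (\<exists>p < length (arcs D). Leg h \<in> set (arcs D ! p))"
proof -
  have "h \<in># legs D \<longleftrightarrow> Leg h \<in> set (concat (arcs D))"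
    by (simp only: legs_def set_mset_mset Leg_in_set_iff)
  also have "\<dots> \<longleftrightarrow> (\<exists>p < length (arcs D). Leg h \<in> set (arcs D ! p))"
    unfolding set_concat UN_iff by (metis in_set_conv_nth)
  finally show ?thesis .
qed

lemma arc_of_leg_unique:
  assumes "distinct_legs D" "p < length (arcs D)" "q < length (arcs D)"
    "Leg h \<in> set (arcs D ! p)" "Leg h \<in> set (arcs D ! q)"
  shows "p = q"
proof -
  let ?c = "\<lambda>xs. count (mset (concat (map item_legs xs))) h"
  have count_concat: "?c (concat As) = (\<Sum>i<length As. ?c (As ! i))" for As
    by (induction As) (simp_all add: sum.lessThan_Suc_shift del: sum.lessThan_Suc)
  have "?c (concat (arcs D)) \<le> 1"
    using assms(1) by (simp add: distinct_legs_def legs_def)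
  then have "(\<Sum>i<length (arcs D). ?c (arcs D ! i)) \<le> 1"
    unfolding count_concat .
  moreover have "?c (arcs D ! p) + ?c (arcs D ! q) \<le> (\<Sum>i<length (arcs D). ?c (arcs D ! i))"
    if "p \<noteq> q"
    using that assms(2,3) sum_mono2[of "{..<length (arcs D)}" "{p, q}" "\<lambda>i. ?c (arcs D ! i)"]
    by auto
  moreover have "?c (arcs D ! p) \<ge> 1" "?c (arcs D ! q) \<ge> 1"
    using assms(4,5) unfolding Leg_in_set_iff by (simp_all add: Suc_le_eq del: set_concat)
  ultimately show ?thesis
    by linarith
qed

text \<open>
  The map of indices underlying a face; \<open>unskip k\<close> inverts it on the numbers other than \<open>k\<close>.
\<close>

definition skip :: "nat \<Rightarrow> nat \<Rightarrow> nat" where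
  "skip k j = (if j < k then j else Suc j)"

definition unskip :: "nat \<Rightarrow> nat \<Rightarrow> nat" where
  "unskip k p = (if p < k then p else p - 1)"

lemma skip_eq_iff: "skip k j = p \<longleftrightarrow> p \<noteq> k \<and> j = unskip k p"
  by (auto simp: skip_def unskip_def)

lemma unskip_skip [simp]: "unskip k (skip k j) = j"
  by (simp add: skip_def unskip_def)

lemma gen_word_face: "gen_word (face k) j = [(skip k j, True)]"
  by (simp add: gen_word_def face_def skip_def)

lemma copies_face:
  assumes "p \<le> m" "k \<le> m"
  shows "copies (face k) m p = (if p = k then {} else {(unskip k p, 0)})"
proof -
  have "p \<noteq> k \<Longrightarrow> unskip k p < m"
    using assms by (simp add: unskip_def) arith
  then show ?thesis
    by (auto simp: copies_def gen_word_face skip_eq_iff)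
qed

lemma remove_nth_conv_map:
  assumes "length xs = Suc m" "k \<le> m"
  shows "remove_nth k xs = map (\<lambda>j. xs ! skip k j) [0..<m]"
  by (rule nth_equalityI) (use assms in \<open>auto simp: remove_nth_def skip_def nth_append min_def\<close>)

text \<open>
  The arc \<open>k\<close> has no copy under the face \<open>k\<close>, and every other arc has exactly one, which is not
  reversed. So a leg on the arc \<open>k\<close> cannot be attached anywhere, and without such legs there is a
  unique attachment, with sign 1.
\<close>

lemma diagram_action_face:
  assumes len: "length (arcs D) = Suc m" and k: "k \<le> m" and D: "distinct_legs D"
  shows "diagram_action (face k) m D =
    (if occupancy D ! k then 0 else basis_vec (delete_arc k D) :: _ \<Rightarrow>\<^sub>0 'k::field)"
proof (cases "occupancy D ! k")
  case True
  then have "attachments (face k) m D = {}"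
    using len k by (auto simp: attachments_def occupancy_def has_legs_def copies_face)
  with True show ?thesis
    by (simp add: diagram_action_def)
next
  case False
  let ?arc = "\<lambda>h. THE p. p < length (arcs D) \<and> Leg h \<in> set (arcs D ! p)"
  let ?q = "\<lambda>p. (unskip k p, 0::nat)"
  \<comment> \<open>The only possible attachment: a leg on the arc \<open>p\<close> goes to the single copy of that arc.\<close>
  define \<phi>\<^sub>0 where "\<phi>\<^sub>0 = restrict (\<lambda>h. ?q (?arc h)) (set_mset (legs D))"
  have empty: "Leg h \<notin> set (arcs D ! k)" for h
    using False k len by (auto simp: occupancy_def has_legs_def)
  have arc: "?arc h = p" if "p < length (arcs D)" "Leg h \<in> set (arcs D ! p)" for h p
    using that arc_of_leg_unique[OF D] by blast
  have copy: "copies (face k) m p = {?q p}" if "p < length (arcs D)" "Leg h \<in> set (arcs D ! p)" for p h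
    using that empty[of h] k len by (cases "p = k") (simp_all add: copies_face)
  have att: "attachments (face k) m D = {\<phi>\<^sub>0}"
  proof (intro equalityI subsetI)
    fix \<phi> assume \<phi>: "\<phi> \<in> attachments (face k) m D"
    show "\<phi> \<in> {\<phi>\<^sub>0}"
    proof (unfold singleton_iff, rule ext)
      fix h
      show "\<phi> h = \<phi>\<^sub>0 h"
      proof (cases "h \<in># legs D")
        case True
        then obtain p where p: "p < length (arcs D)" "Leg h \<in> set (arcs D ! p)"
          by (auto simp: in_legs_iff)
        with \<phi> have "\<phi> h \<in> copies (face k) m p"
          by (auto simp: attachments_def)
        with p True show ?thesis
          by (simp add: copy[OF p] \<phi>\<^sub>0_def arc[OF p])
      next
        case False
        with \<phi> show ?thesis
          by (simp add: attachments_def \<phi>\<^sub>0_def extensional_def)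
      qed
    qed
  next
    fix \<phi> assume "\<phi> \<in> {\<phi>\<^sub>0}"
    have "\<phi>\<^sub>0 h \<in> copies (face k) m p" if p: "p < length (arcs D)" "Leg h \<in> set (arcs D ! p)" for p h
    proof -
      from p have "h \<in># legs D"
        by (auto simp: in_legs_iff)
      then show ?thesis
        by (simp add: copy[OF p] \<phi>\<^sub>0_def arc[OF p])
    qed
    then show "\<phi> \<in> attachments (face k) m D"
      using \<open>\<phi> \<in> {\<phi>\<^sub>0}\<close> by (auto simp: attachments_def \<phi>\<^sub>0_def)
  qed
  have "snd (gen_word (face k) (fst (\<phi>\<^sub>0 h)) ! snd (\<phi>\<^sub>0 h))" if "h \<in># legs D" for h
    using that by (simp add: \<phi>\<^sub>0_def gen_word_face)
  then have "reversed_legs (face k) \<phi>\<^sub>0 D = {}"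
    by (auto simp: reversed_legs_def case_prod_beta)
  moreover have "attach (face k) m \<phi>\<^sub>0 D = delete_arc k D"
  proof -
    have "arc_copy \<phi>\<^sub>0 (j, 0) True (arcs D ! skip k j) =
        arcs D ! skip k j" (is "arc_copy _ _ _ (arcs D ! ?p) = _")
      if "j < m" for j
    proof -
      have "on_copy \<phi>\<^sub>0 (j, 0) x" if x: "x \<in> set (arcs D ! ?p)" for x
      proof (cases x)
        case (Leg h)
        have p: "?p < length (arcs D)"
          using \<open>j < m\<close> len by (simp add: skip_def)
        have "h \<in># legs D"
          using Leg x p by (auto simp only: in_legs_iff)
        then have "\<phi>\<^sub>0 h = ?q ?p"
          using arc[OF p] x Leg by (simp only: \<phi>\<^sub>0_def restrict_apply if_True)
        also have "?q ?p = (j, 0)"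
          by simp
        finally show ?thesis
          by (simp add: Leg)
      qed simp
      then show ?thesis
        by (simp add: arc_copy_def filter_id_conv del: filter_True)
    qed
    then have "map (\<lambda>j. arc_copy \<phi>\<^sub>0 (j, 0) True (arcs D ! skip k j)) [0..<m] =
        remove_nth k (arcs D)"
      unfolding remove_nth_conv_map[OF len k] by (intro map_cong refl) simp
    then show ?thesis
      by (simp add: attach_def gen_word_face delete_arc_def map_arcs_def)
  qed
  ultimately show ?thesis
    using False by (simp add: diagram_action_def att)
qed

lemma diagram_action_face_diagrams:
  assumes "D \<in> diagrams n (Suc m)" "k \<le> m"
  shows "diagram_action (face k) m D =
    (if occupancy D ! k then 0 else basis_vec (delete_arc k D) :: _ \<Rightarrow>\<^sub>0 'k::field)"
  using assms distinct_legs_diagrams by (intro diagram_action_face) (auto simp: diagrams_def)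

lemma delete_arc_move:
  assumes "diagram_move n D D'" "\<not> occupancy D ! k"
  shows "delete_arc k D = delete_arc k D' \<or> diagram_move n (delete_arc k D) (delete_arc k D')"
  unfolding delete_arc_def using assms(1)
proof (rule diagram_move_map_arcs)
  show "remove_nth k (map (map f) xss) = map (map f) (remove_nth k xss)" for f xss
    by (simp add: remove_nth_def take_map drop_map)
  show "local_at (remove_nth k) p \<or> \<not> occupancy D ! p \<and> blind_at (remove_nth k) p" for p
    using assms(2) by (cases "p = k") (simp_all add: local_at_remove_nth blind_at_remove_nth)
qed

text \<open>
  The faces act on the quotients, because deletion of an arc is compatible with the moves and
  with STU, and because all terms of a relation have the same occupied arcs: either every term is
  killed or none is.
\<close>

lemma linear_action_face_relations:
  fixes v :: "diagram \<Rightarrow>\<^sub>0 'k::field"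
  assumes "v \<in> relations n (Suc m)" and k: "k \<le> m"
  shows "linear_action (face k) m v \<in> relations n m"
  unfolding linear_action_eq using assms(1) subspace_relations
proof (rule lin_ext_relations)
  fix D D'
  assume D: "D \<in> diagrams n (Suc m)" "D' \<in> diagrams n (Suc m)" and "diagram_move n D D'"
  then have "occupancy D = occupancy D'"
      "\<not> occupancy D ! k \<Longrightarrow>
        delete_arc k D = delete_arc k D' \<or> diagram_move n (delete_arc k D) (delete_arc k D')"
    using occupancy_move delete_arc_move by blast+
  with D k show "(diagram_action (face k) m D :: diagram \<Rightarrow>\<^sub>0 'k) - diagram_action (face k) m D'
      \<in> relations n m"
    by (simp add: diagram_action_face_diagrams relations_moveI delete_arc_in_diagrams
        zero_in_relations)
next
  fix D D\<^sub>1 D\<^sub>2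
  assume D: "D \<in> diagrams n (Suc m)" and stu: "stu D D\<^sub>1 D\<^sub>2"
  have occ: "occupancy D\<^sub>1 = occupancy D" "occupancy D\<^sub>2 = occupancy D"
    using occupancy_stu[OF stu] by simp_all
  have "length (arcs D) = Suc m"
    using D by (simp add: diagrams_def)
  moreover from this have "length (arcs D\<^sub>1) = Suc m" "length (arcs D\<^sub>2) = Suc m"
    using occ[THEN arg_cong[of _ _ length]] by (simp_all add: occupancy_def)
  ultimately have act: "diagram_action (face k) m X =
      (if occupancy D ! k then 0 else basis_vec (delete_arc k X) :: _ \<Rightarrow>\<^sub>0 'k)"
    if "X \<in> {D, D\<^sub>1, D\<^sub>2}" for X
    using that k occ distinct_legs_diagrams[OF D] distinct_legs_stu[OF D stu]
    by (auto simp: diagram_action_face)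
  show "(diagram_action (face k) m D :: diagram \<Rightarrow>\<^sub>0 'k)
      - (diagram_action (face k) m D\<^sub>1 - diagram_action (face k) m D\<^sub>2)
      \<in> relations n m"
  proof (cases "occupancy D ! k")
    case True
    then show ?thesis
      by (simp add: act zero_in_relations)
  next
    case False
    then have "stu (delete_arc k D) (delete_arc k D\<^sub>1) (delete_arc k D\<^sub>2)"
      unfolding delete_arc_def by (intro stu_map_arcs[OF stu] local_at_remove_nth) auto
    with False D k show ?thesis
      by (simp add: act relations_stuI delete_arc_in_diagrams)
  qed
qed


section \<open>Polynomiality as a statement about representatives\<close>

lemma relations_coset:
  fixes r :: "diagram \<Rightarrow>\<^sub>0 'k::field"
  shows "r \<in> relations n m \<Longrightarrow> r +o relations n m = relations n m"
proof (intro equalityI subsetI)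
  fix x :: "diagram \<Rightarrow>\<^sub>0 'k"
  assume "r \<in> relations n m" "x \<in> relations n m"
  then have "r + (x - r) \<in> r +o relations n m"
    by (intro set_plus_intro2 pm.subspace_diff[OF subspace_relations])
  then show "x \<in> r +o relations n m"
    by simp
qed (auto simp: elt_set_plus_def intro: pm.subspace_add[OF subspace_relations])

text \<open>
  The induced map on cosets is a union over all representatives. As the action preserves the
  relations, one representative decides whether the image is the zero coset.
\<close>

lemma coset_in_face_kernel_iff:
  fixes v :: "diagram \<Rightarrow>\<^sub>0 'k::field"
  assumes k: "k \<le> m"
  shows "(\<Union>u\<in>v +o relations n (Suc m). linear_action (face k) m u +o relations n m) = relations n m
    \<longleftrightarrow> linear_action (face k) m v \<in> relations n m" (is "?U = _ \<longleftrightarrow> _")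
proof
  assume U: "?U = relations n m"
  have "linear_action (face k) m v + 0 \<in> linear_action (face k) m v +o relations n m"
    by (intro set_plus_intro2 zero_in_relations)
  moreover have "v + 0 \<in> v +o relations n (Suc m)"
    by (intro set_plus_intro2 zero_in_relations)
  ultimately show "linear_action (face k) m v \<in> relations n m"
    using U by auto
next
  assume v: "linear_action (face k) m v \<in> relations n m"
  have "linear_action (face k) m u +o relations n m = relations n m"
    if u: "u \<in> v +o relations n (Suc m)" for u
  proof -
    have "linear_action (face k) m u =
        linear_action (face k) m v + linear_action (face k) m (u - v)"
      by (simp add: linear_action_eq lin_ext_diff)
    moreover have "u - v \<in> relations n (Suc m)"
      using u by (rule set_plus_imp_minus)
    ultimately show ?thesis
      using v k by (simp add: relations_coset linear_action_face_relations
          pm.subspace_add[OF subspace_relations])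
  qed
  moreover have "v + 0 \<in> v +o relations n (Suc m)"
    by (intro set_plus_intro2 zero_in_relations)
  ultimately show "?U = relations n m"
    by blast
qed

text \<open>
  The quotient spaces are eliminated here once and for all: what remains is a condition on linear
  combinations of diagrams modulo relations.
\<close>

lemma polynomial_of_degree_le_jacobi_functor_iff:
  "polynomial_of_degree_le (jacobi_functor d n :: ('k::field, (diagram \<Rightarrow>\<^sub>0 'k) set) gr_op_functor) e
   \<longleftrightarrow>
   (\<forall>v\<in>pm.span (basis_vec ` {D \<in> diagrams n (Suc e). has_degree D d}) :: (diagram \<Rightarrow>\<^sub>0 'k) set.
      (\<forall>k\<le>e. linear_action (face k) e v \<in> relations n e) \<longrightarrow> v \<in> relations n (Suc e))"
  (is "_ \<longleftrightarrow> (\<forall>v\<in>?S. (\<forall>k\<le>e. ?L k v \<in> ?R) \<longrightarrow> v \<in> ?R')")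
proof -
  let ?N = "jacobi_functor d n :: ('k, (diagram \<Rightarrow>\<^sub>0 'k) set) gr_op_functor"
  let ?K = "\<Inter>k\<in>{..e}. a_kernel (obj ?N (Suc e)) (obj ?N e) (arr ?N e (Suc e) (face k))"
  let ?U = "\<lambda>k X. \<Union>u\<in>X. ?L k u +o ?R"
  have inter: "(\<Inter>k\<in>{..e}. {X \<in> C. P k X}) = {X \<in> C. \<forall>k\<le>e. P k X}" for C :: "'x set" and P
    by auto
  have image: "{X \<in> (\<lambda>v. v +o ?R') ` ?S. P X} = (\<lambda>v. v +o ?R') ` {v \<in> ?S. P (v +o ?R')}" for P
    by auto
  have "?K = {X \<in> (\<lambda>v. v +o ?R') ` ?S. \<forall>k\<le>e. ?U k X = ?R}"
    unfolding a_kernel_def' inter by (simp add: jacobi_functor_def jacobi_space_deg_def jacobi_space_def)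
  also have "\<dots> = (\<lambda>v. v +o ?R') ` {v \<in> ?S. \<forall>k\<le>e. ?L k v \<in> ?R}"
    unfolding image by (simp only: coset_in_face_kernel_iff cong: imp_cong)
  finally have K: "?K = (\<lambda>v. v +o ?R') ` {v \<in> ?S. \<forall>k\<le>e. ?L k v \<in> ?R}" .
  have coset: "v +o ?R' = ?R' \<longleftrightarrow> v \<in> ?R'" for v
    using relations_coset set_plus_intro2[OF zero_in_relations, of v n "Suc e"] by fastforce
  have 0: "0 \<in> {v \<in> ?S. \<forall>k\<le>e. ?L k v \<in> ?R}"
    by (simp add: pm.span_zero linear_action_eq zero_in_relations)
  have "polynomial_of_degree_le ?N e \<longleftrightarrow> ?K = {?R'}"
    by (simp add: polynomial_of_degree_le_def jacobi_functor_def jacobi_space_deg_def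
        jacobi_space_def)
  also have "\<dots> \<longleftrightarrow> (\<forall>v\<in>{v \<in> ?S. \<forall>k\<le>e. ?L k v \<in> ?R}. v +o ?R' = ?R')"
    unfolding K using 0 by blast
  finally show ?thesis
    by (auto simp: coset)
qed


section \<open>Polynomiality without beads\<close>

lemma insert_arc_relations:
  fixes v :: "diagram \<Rightarrow>\<^sub>0 'k::field"
  assumes "v \<in> relations n m" and k: "k \<le> m"
  shows "lin_ext (\<lambda>D. basis_vec (insert_arc k D)) v \<in> relations n (Suc m)"
  using assms(1) subspace_relations
proof (rule lin_ext_relations)
  fix D D'
  assume D: "D \<in> diagrams n m" "D' \<in> diagrams n m" and "diagram_move n D D'"
  from this(3) have "insert_arc k D = insert_arc k D' \<or> diagram_move n (insert_arc k D) (insert_arc k D')"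
    unfolding insert_arc_def
  proof (rule diagram_move_map_arcs)
    show "insert_nil k (map (map f) xss) = map (map f) (insert_nil k xss)" for f xss
      by (simp add: insert_nil_def take_map drop_map)
    show "local_at (insert_nil k) p \<or> \<not> occupancy D ! p \<and> blind_at (insert_nil k) p" for p
      by (simp add: local_at_insert_nil)
  qed
  then show "(basis_vec (insert_arc k D) :: diagram \<Rightarrow>\<^sub>0 'k) - basis_vec (insert_arc k D') \<in> relations n (Suc m)"
    by (intro relations_moveI insert_arc_in_diagrams D k)
next
  fix D D\<^sub>1 D\<^sub>2
  assume "D \<in> diagrams n m" "stu D D\<^sub>1 D\<^sub>2"
  then show "(basis_vec (insert_arc k D) :: diagram \<Rightarrow>\<^sub>0 'k) - (basis_vec (insert_arc k D\<^sub>1) - basis_vec (insert_arc k D\<^sub>2))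
      \<in> relations n (Suc m)"
    unfolding insert_arc_def
    by (intro relations_stuI stu_map_arcs local_at_insert_nil
        insert_arc_in_diagrams[unfolded insert_arc_def] k)
qed

text \<open>
  Since all relations are homogeneous with respect to the set of occupied arcs, these projections
  descend to the quotients, which are therefore graded by that set.
\<close>

definition restrict_occupancy :: "(bool list \<Rightarrow> bool) \<Rightarrow> (diagram \<Rightarrow>\<^sub>0 'k::field) \<Rightarrow> (diagram \<Rightarrow>\<^sub>0 'k)"
  where "restrict_occupancy P = lin_ext (\<lambda>D. if P (occupancy D) then basis_vec D else 0)"

lemma restrict_occupancy_relations:
  fixes v :: "diagram \<Rightarrow>\<^sub>0 'k::field"
  assumes "v \<in> relations n m"
  shows "restrict_occupancy P v \<in> relations n m"
  unfolding restrict_occupancy_def using assms subspace_relations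
proof (rule lin_ext_relations)
  fix D D'
  assume "D \<in> diagrams n m" "D' \<in> diagrams n m" "diagram_move n D D'"
  then show "((if P (occupancy D) then basis_vec D else 0) :: diagram \<Rightarrow>\<^sub>0 'k)
      - (if P (occupancy D') then basis_vec D' else 0) \<in> relations n m"
    by (simp add: occupancy_move[of n D D'] relations_moveI zero_in_relations)
next
  fix D D\<^sub>1 D\<^sub>2
  assume "D \<in> diagrams n m" "stu D D\<^sub>1 D\<^sub>2"
  then show "((if P (occupancy D) then basis_vec D else 0) :: diagram \<Rightarrow>\<^sub>0 'k)
      - ((if P (occupancy D\<^sub>1) then basis_vec D\<^sub>1 else 0)
         - (if P (occupancy D\<^sub>2) then basis_vec D\<^sub>2 else 0)) \<in> relations n m"
    using occupancy_stu[of D D\<^sub>1 D\<^sub>2] by (simp add: relations_stuI zero_in_relations)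
qed

lemma carrier_free_group_0: "w \<in> carrier (free_group 0) \<Longrightarrow> w = []"
  by (auto simp: free_group_def)

lemma clear_arc:
  assumes "Diagram (As @ xs # Bs) E T \<in> diagrams 0 m" "\<not> has_legs xs"
  shows "basis_vec (Diagram (As @ [] # Bs) E T) - basis_vec (Diagram (As @ xs # Bs) E T)
    \<in> (relations 0 m :: (diagram \<Rightarrow>\<^sub>0 'k::field) set)"
  using assms
proof (induction xs)
  case Nil
  then show ?case by (simp add: zero_in_relations)
next
  case (Cons x xs)
  then obtain w where w: "x = Bead w"
    by (cases x) auto
  with Cons.prems(1) have "w \<in> carrier (free_group 0)"
    unfolding diagrams_def by simp
  then have "w = []"
    by (rule carrier_free_group_0)
  with w have x: "x = Bead \<one>\<^bsub>free_group 0\<^esub>"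
    by (simp add: free_group_def)
  let ?D = "Diagram (As @ (x # xs) # Bs) E T" and ?D' = "Diagram (As @ xs # Bs) E T"
  have "length (arcs ?D) = m"
    using Cons.prems(1) unfolding diagrams_def by blast
  then have "map_arcs (\<lambda>_. As @ xs # Bs) ?D \<in> diagrams 0 m"
    by (intro map_arcs_in_diagrams[OF Cons.prems(1)]) (auto simp: map_arcs_def legs_def w)
  then have D': "?D' \<in> diagrams 0 m"
    by (simp add: map_arcs_def)
  have "diagram_move 0 ?D ?D'"
    using diagram_move.arc_one[of 0 As "[]" xs Bs E T] by (simp add: x)
  then have "basis_vec ?D - basis_vec ?D' \<in> (relations 0 m :: (diagram \<Rightarrow>\<^sub>0 'k) set)"
    by (intro relations_moveI Cons.prems D') simp
  moreover have "basis_vec (Diagram (As @ [] # Bs) E T) - basis_vec ?D' \<in> (relations 0 m :: (diagram \<Rightarrow>\<^sub>0 'k) set)"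
    using Cons D' w by simp
  ultimately have "(basis_vec (Diagram (As @ [] # Bs) E T) - basis_vec ?D')
      - (basis_vec ?D - basis_vec ?D') \<in> (relations 0 m :: (diagram \<Rightarrow>\<^sub>0 'k) set)"
    using pm.subspace_diff[OF subspace_relations] by blast
  then show ?case
    by simp
qed

text \<open>
  For \<open>n = 0\<close> all beads are trivial and can be removed, so an arc without legs is as good as an
  empty one.
\<close>

lemma insert_delete_arc:
  assumes D: "D \<in> diagrams 0 (Suc m)" and k: "k \<le> m" "\<not> occupancy D ! k"
  shows "basis_vec (insert_arc k (delete_arc k D)) - basis_vec D
    \<in> (relations 0 (Suc m) :: (diagram \<Rightarrow>\<^sub>0 'k::field) set)"
proof -
  let ?As = "take k (arcs D)" and ?Bs = "drop (Suc k) (arcs D)"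
  have len: "length (arcs D) = Suc m"
    using D by (simp add: diagrams_def)
  with k have split: "D = Diagram (?As @ arcs D ! k # ?Bs) (edges D) (triv D)"
    by (simp add: id_take_nth_drop[symmetric])
  have "basis_vec (Diagram (?As @ [] # ?Bs) (edges D) (triv D))
      - basis_vec (Diagram (?As @ arcs D ! k # ?Bs) (edges D) (triv D))
      \<in> (relations 0 (Suc m) :: (diagram \<Rightarrow>\<^sub>0 'k) set)"
    using D split k len by (intro clear_arc) (simp_all add: occupancy_def)
  moreover have "insert_arc k (delete_arc k D) = Diagram (?As @ [] # ?Bs) (edges D) (triv D)"
    using len k by (simp add: insert_arc_def delete_arc_def map_arcs_def insert_nil_def
        remove_nth_def min_def)
  ultimately show ?thesis
    by (simp flip: split)
qed

text \<open>
  A linear combination in the kernel of the face \<open>k\<close> vanishes, modulo relations, on the diagrams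
  that do not use the arc \<open>k\<close>, because there the face has a left inverse. The other diagrams are
  killed by the face.
\<close>

lemma restrict_unoccupied_in_relations:
  fixes v :: "diagram \<Rightarrow>\<^sub>0 'k::field"
  assumes v: "Poly_Mapping.keys v \<subseteq> diagrams 0 (Suc m)" and k: "k \<le> m"
    and act: "linear_action (face k) m v \<in> relations 0 m"
  shows "restrict_occupancy (\<lambda>occ. \<not> occ ! k) v \<in> relations 0 (Suc m)"
proof -
  let ?ins = "lin_ext (\<lambda>D. basis_vec (insert_arc k D))"
  have "?ins (linear_action (face k) m v) - restrict_occupancy (\<lambda>occ. \<not> occ ! k) v =
      lin_ext (\<lambda>D. ?ins (diagram_action (face k) m D)
        - (if \<not> occupancy D ! k then basis_vec D else 0)) v"
    by (simp add: linear_action_eq lin_ext_lin_ext lin_ext_diff_fun restrict_occupancy_def)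
  also have "\<dots> \<in> relations 0 (Suc m)"
    using v k by (intro lin_ext_in_subspace subspace_relations)
      (auto simp: diagram_action_face_diagrams insert_delete_arc zero_in_relations)
  finally have "?ins (linear_action (face k) m v) - restrict_occupancy (\<lambda>occ. \<not> occ ! k) v
      \<in> relations 0 (Suc m)" .
  moreover have "?ins (linear_action (face k) m v) \<in> relations 0 (Suc m)"
    by (intro insert_arc_relations act k)
  ultimately show ?thesis
    using pm.subspace_diff[OF subspace_relations] by fastforce
qed

lemma length_le_legs:
  "(\<And>xs. xs \<in> set As \<Longrightarrow> has_legs xs) \<Longrightarrow> length As \<le> length (concat (map item_legs (concat As)))"
proof (induction As)
  case (Cons xs As)
  then obtain h where "Leg h \<in> set xs"
    by (auto simp: has_legs_def)
  then have "concat (map item_legs xs) \<noteq> []"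
    unfolding Leg_in_set_iff by force
  then have "1 \<le> length (concat (map item_legs xs))"
    by (metis One_nat_def Suc_leI length_greater_0_conv)
  then show ?case
    using Cons by simp
qed simp

text \<open>
  A diagram of degree \<open>d\<close> has \<open>2 * d\<close> vertices and hence at most \<open>2 * d\<close> legs, so \<open>2 * d + 1\<close> arcs
  cannot all be occupied.
\<close>

lemma exists_unoccupied:
  assumes D: "D \<in> diagrams n (Suc (2 * d))" and deg: "has_degree D d"
  shows "\<exists>k\<le>2 * d. \<not> occupancy D ! k"
proof (rule ccontr)
  have len: "length (arcs D) = Suc (2 * d)"
    using D by (simp add: diagrams_def)
  assume "\<not> ?thesis"
  then have "has_legs xs" if "xs \<in> set (arcs D)" for xs
    using that len by (auto simp: occupancy_def in_set_conv_nth less_Suc_eq_le)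
  then have "length (arcs D) \<le> size (legs D)"
    unfolding legs_def size_mset by (rule length_le_legs)
  with len deg show False
    by (simp add: has_degree_def)
qed

text \<open>
  Every diagram of degree \<open>d\<close> on \<open>2 * d + 1\<close> arcs belongs to the part where the arc \<open>k\<close> is the
  first one without legs, for a unique \<open>k \<le> 2 * d\<close>. Of a vector that the face \<open>k\<close> kills, the part
  belonging to \<open>k\<close> vanishes modulo relations.
\<close>

lemma polynomial_without_beads:
  "polynomial_of_degree_le
     (jacobi_functor d 0 :: ('k::field, (diagram \<Rightarrow>\<^sub>0 'k) set) gr_op_functor) (2 * d)"
  unfolding polynomial_of_degree_le_jacobi_functor_iff
proof (intro ballI impI)
  let ?m = "Suc (2 * d)"
  fix v :: "diagram \<Rightarrow>\<^sub>0 'k"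
  assume v: "v \<in> pm.span (basis_vec ` {D \<in> diagrams 0 ?m. has_degree D d})"
    and ker: "\<forall>k\<le>2 * d. linear_action (face k) (2 * d) v \<in> relations 0 (2 * d)"
  have keys: "Poly_Mapping.keys v \<subseteq> {D \<in> diagrams 0 ?m. has_degree D d}"
    using v by (rule keys_of_span_basis)
  define first where "first k = (\<lambda>occ. \<not> occ ! k \<and> (\<forall>i<k. occ ! i))" for k :: nat
  have "(\<Sum>k\<le>2 * d. if first k (occupancy D) then basis_vec D else 0) = basis_vec D"
    if "D \<in> Poly_Mapping.keys v" for D
  proof -
    define k where "k = (LEAST k. \<not> occupancy D ! k)"
    have "D \<in> diagrams 0 ?m" "has_degree D d"
      using that keys by auto
    then obtain k' where k': "k' \<le> 2 * d" "\<not> occupancy D ! k'"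
      using exists_unoccupied by metis
    have "k \<le> k'"
      unfolding k_def using k'(2) by (rule Least_le)
    with k'(1) have "k \<le> 2 * d"
      by simp
    have "\<not> occupancy D ! k"
      unfolding k_def using k'(2) by (rule LeastI)
    moreover have "occupancy D ! i" if "i < k" for i
      using that not_less_Least[of i "\<lambda>k. \<not> occupancy D ! k"] by (simp add: k_def)
    ultimately have "first i (occupancy D) \<longleftrightarrow> i = k" for i
      unfolding first_def by (metis linorder_neqE_nat)
    with \<open>k \<le> 2 * d\<close> show ?thesis
      by simp
  qed
  then have "lin_ext (\<lambda>D. \<Sum>k\<le>2 * d. if first k (occupancy D) then basis_vec D else 0) v
      = lin_ext basis_vec v"
    by (rule lin_ext_cong)
  then have "v = (\<Sum>k\<le>2 * d. restrict_occupancy (first k) v)"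
    by (simp add: lin_ext_sum_fun restrict_occupancy_def lin_ext_basis_vec)
  also have "\<dots> =
      (\<Sum>k\<le>2 * d. restrict_occupancy (first k) (restrict_occupancy (\<lambda>occ. \<not> occ ! k) v))"
    unfolding restrict_occupancy_def lin_ext_lin_ext
    by (intro sum.cong refl lin_ext_cong) (auto simp: first_def)
  also have "\<dots> \<in> relations 0 ?m"
    using keys ker
    by (intro pm.subspace_sum[OF subspace_relations] restrict_occupancy_relations
        restrict_unoccupied_in_relations) auto
  finally show "v \<in> relations 0 ?m" .
qed


section \<open>Holonomy of the arcs\<close>

fun arc_word :: "item list \<Rightarrow> fword" where
  "arc_word [] = []"
| "arc_word (Bead w # xs) = foldr push w (arc_word xs)"
| "arc_word (Leg h # xs) = arc_word xs"

text \<open>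
  The product of the beads along each arc, ignoring the legs, is an invariant of beaded diagrams:
  when a bead slides past a leg, the same bead stays on the arc.
\<close>

definition holonomy :: "diagram \<Rightarrow> fword list" where
  "holonomy D = map arc_word (arcs D)"

lemma arc_word_reduced: "successively (\<lambda>x y. y \<noteq> flip x) (arc_word xs)"
  by (induction xs rule: arc_word.induct) (simp_all add: foldr_push_reduced)

lemma arc_word_append_cong: "arc_word xs = arc_word ys \<Longrightarrow> arc_word (us @ xs) = arc_word (us @ ys)"
  by (induction us rule: arc_word.induct) simp_all

lemma arc_word_relabel: "arc_word (map (relabel_item f) xs) = arc_word xs"
  by (induction xs rule: arc_word.induct) simp_all

lemma holonomy_move: "diagram_move n D D' \<Longrightarrow> holonomy D = holonomy D'"
  by (induction rule: diagram_move.induct)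
     (auto simp: holonomy_def relabel_def arc_word_relabel free_group_def
        foldr_push_assoc[OF arc_word_reduced] intro!: arc_word_append_cong)

lemma holonomy_stu: "stu D D\<^sub>1 D\<^sub>2 \<Longrightarrow> holonomy D\<^sub>1 = holonomy D\<^sub>2"
  by (induction rule: stu.induct) (auto simp: holonomy_def intro!: arc_word_append_cong)

lemma triv_move: "diagram_move n D D' \<Longrightarrow> triv D = {#} \<longleftrightarrow> triv D' = {#}"
  by (induction rule: diagram_move.induct) (auto simp: relabel_def)

lemma triv_stu: "stu D D\<^sub>1 D\<^sub>2 \<Longrightarrow> triv D \<noteq> {#} \<and> triv D\<^sub>1 = triv D\<^sub>2"
  by (induction rule: stu.induct) simp

text \<open>
  Diagrams with trivalent vertices are sent to zero and the others to their holonomies, in the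
  space spanned by lists of words, which for \<open>m\<close> arcs contains the group algebra of \<open>F_n\<^sup>m\<close>.
  The left-hand side of STU has a trivalent vertex, and the two terms on the right-hand side differ
  only in the order of legs, which the holonomy ignores; so their images cancel.
\<close>

definition weight :: "diagram \<Rightarrow> (fword list \<Rightarrow>\<^sub>0 'k::field)" where
  "weight D = (if triv D = {#} then basis_vec (holonomy D) else 0)"

lemma weight_relations:
  assumes "v \<in> relations n m"
  shows "lin_ext weight v = 0"
proof -
  have "lin_ext weight v \<in> {0}"
    using assms pm.subspace_single_0
  proof (rule lin_ext_relations)
    fix D D'
    assume "diagram_move n D D'"
    then show "weight D - weight D' \<in> {0}"
      using triv_move holonomy_move by (auto simp: weight_def)
  next
    fix D D\<^sub>1 D\<^sub>2
    assume "stu D D\<^sub>1 D\<^sub>2"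
    then show "weight D - (weight D\<^sub>1 - weight D\<^sub>2) \<in> {0}"
      using triv_stu holonomy_stu by (auto simp: weight_def)
  qed
  then show ?thesis by simp
qed


section \<open>Alternating sums of beaded diagrams\<close>

text \<open>
  All \<open>2 * d\<close> legs, paired to \<open>d\<close> chords, lie on the arc 0, so that only the face 0 can detect
  them, and this face acts by zero if \<open>d > 0\<close>. Every arc in \<open>S\<close>, possibly including the arc 0,
  has one bead \<open>x_0\<close>, which is available as soon as \<open>n > 0\<close>.
\<close>

definition beaded_chords :: "nat \<Rightarrow> nat \<Rightarrow> nat set \<Rightarrow> diagram" where
  "beaded_chords d m S = Diagram
     (map (\<lambda>i. (if i \<in> S then [Bead [(0, True)]] else []) @
               (if i = 0 then map Leg [0..<2 * d] else [])) [0..<m])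
     (mset (map (\<lambda>i. (2 * i, [], 2 * i + 1)) [0..<d])) {#}"

lemma edge_ends_beaded_chords: "edge_ends (beaded_chords d m S) = mset [0..<2 * d]"
  unfolding edge_ends_def beaded_chords_def by (induction d) simp_all

lemma legs_beaded_chords: "legs (beaded_chords d (Suc m) S) = mset [0..<2 * d]"
proof -
  have "concat (map item_legs (map Leg hs)) = hs" for hs
    by (induction hs) simp_all
  moreover have "concat (map item_legs (concat (map (\<lambda>i. if Suc i \<in> S then [Bead w] else []) is))) = []"
    for w "is"
    by (induction "is") simp_all
  ultimately show ?thesis
    by (simp add: legs_def beaded_chords_def upt_conv_Cons[of 0 "Suc m"] map_Suc_upt[symmetric]
        comp_def del: upt_Suc map_map)
qed

lemma beaded_chords_in_diagrams:
  assumes "0 < n"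
  shows "beaded_chords d (Suc m) S \<in> diagrams n (Suc m)"
proof -
  let ?D = "beaded_chords d (Suc m) S"
  have "[(0, True)] \<in> carrier (free_group n)"
    using assms by (simp add: free_group_def)
  then have "w \<in> carrier (free_group n)" if "Bead w \<in> set (concat (arcs ?D))" for w
    using that by (auto simp: beaded_chords_def split: if_splits)
  moreover have "\<forall>(s, ws, t)\<in>#edges ?D. set ws \<subseteq> carrier (free_group n)"
    by (auto simp: beaded_chords_def)
  moreover have "vertex_ends ?D = legs ?D"
    by (simp add: vertex_ends_def beaded_chords_def)
  moreover have "count (mset [0..<2 * d]) h \<le> 1" for h
    using distinct_count_atmost_1[of "[0..<2 * d]"] by simp
  ultimately show ?thesis
    unfolding diagrams_def edge_ends_beaded_chords legs_beaded_chords
    by (auto simp: edge_ends_beaded_chords legs_beaded_chords) (simp add: beaded_chords_def)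
qed

lemma has_degree_beaded_chords: "has_degree (beaded_chords d (Suc m) S) d"
  by (simp add: has_degree_def legs_beaded_chords) (simp add: beaded_chords_def)

lemma has_legs_map_Leg [simp]: "has_legs (map Leg hs) \<longleftrightarrow> hs \<noteq> []"
  by (cases hs) simp_all

lemma triv_beaded_chords [simp]: "triv (beaded_chords d m S) = {#}"
  by (simp add: beaded_chords_def)

lemma occupancy_beaded_chords:
  "occupancy (beaded_chords d m S) = map (\<lambda>i. i = 0 \<and> 0 < d) [0..<m]"
  by (auto simp: occupancy_def beaded_chords_def)

lemma delete_arc_beaded_chords:
  assumes "k < m"
  shows "delete_arc k (beaded_chords d m (insert k S)) = delete_arc k (beaded_chords d m S)"
  using assms
  by (auto simp: delete_arc_def map_arcs_def remove_nth_def beaded_chords_def take_map drop_map)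

text \<open>
  The subsets cancel in pairs \<open>S\<close> and \<open>insert a S\<close>.
\<close>

lemma alternating_sum_Pow_eq_0:
  fixes f :: "'a set \<Rightarrow> ('b \<Rightarrow>\<^sub>0 'k::field)"
  assumes "finite A" "a \<in> A" and f: "\<And>S. f (insert a S) = f S"
  shows "(\<Sum>S\<in>Pow A. pm_scale ((- 1) ^ card S) (f S)) = 0"
proof -
  define B where "B = A - {a}"
  have A: "A = insert a B" "a \<notin> B" "finite B"
    using assms by (auto simp: B_def)
  have "inj_on (insert a) (Pow B)"
    using A(2) by (auto simp: inj_on_def)
  moreover have "pm_scale ((- 1) ^ card (insert a S)) (f (insert a S))
      = - pm_scale ((- 1) ^ card S) (f S)" if "S \<in> Pow B" for S
    using that A finite_subset[of S B] by (subst card_insert_disjoint) (auto simp: f)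
  ultimately have "(\<Sum>S\<in>insert a ` Pow B. pm_scale ((- 1) ^ card S) (f S))
      = - (\<Sum>S\<in>Pow B. pm_scale ((- 1) ^ card S) (f S))"
    by (simp add: sum.reindex sum_negf)
  moreover have "Pow B \<inter> insert a ` Pow B = {}"
    using A(2) by auto
  ultimately show ?thesis
    using A(3) by (simp add: A(1) Pow_insert sum.union_disjoint)
qed

text \<open>
  For \<open>d = 0\<close> this is, up to sign, the product over all arcs of the elements \<open>x_0 - 1\<close> of the group
  algebra. For \<open>d > 0\<close> it is the same element with the chords added on the arc 0.
\<close>

definition alternating_chords :: "nat \<Rightarrow> nat \<Rightarrow> (diagram \<Rightarrow>\<^sub>0 'k::field)" where
  "alternating_chords d m =
     (\<Sum>S\<in>Pow {..<m}. pm_scale ((- 1) ^ card S) (basis_vec (beaded_chords d m S)))"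

lemma lin_ext_alternating_chords:
  "lin_ext F (alternating_chords d m) =
     (\<Sum>S\<in>Pow {..<m}. pm_scale ((- 1) ^ card S) (F (beaded_chords d m S)))"
  by (simp add: alternating_chords_def lin_ext_sum lin_ext_scale)

lemma face_kills_alternating_chords:
  assumes "k \<le> m"
  shows "linear_action (face k) m (alternating_chords d (Suc m)) = (0 :: diagram \<Rightarrow>\<^sub>0 'k::field)"
  unfolding linear_action_eq lin_ext_alternating_chords
proof (rule alternating_sum_Pow_eq_0)
  \<comment> \<open>The action does not see the bead on the arc \<open>k\<close>: it is deleted with its arc. The rank
    of the free group of beads does not enter the action, so these may be seen as diagrams for rank 1.\<close>
  show "diagram_action (face k) m (beaded_chords d (Suc m) (insert k S))
      = (diagram_action (face k) m (beaded_chords d (Suc m) S) :: diagram \<Rightarrow>\<^sub>0 'k)" for S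
    using assms
    by (simp add: diagram_action_face_diagrams[OF beaded_chords_in_diagrams[OF zero_less_one]]
        occupancy_beaded_chords delete_arc_beaded_chords)
qed (use assms in auto)

text \<open>
  The holonomies of the terms are pairwise distinct; the coefficient of the one in which every arc
  reads \<open>x_0\<close> is a sign.
\<close>

lemma weight_alternating_chords: "lin_ext weight (alternating_chords d m :: diagram \<Rightarrow>\<^sub>0 'k::field) \<noteq> 0"
proof -
  let ?hol = "\<lambda>S. map (\<lambda>i. if i \<in> S then [(0, True)] else []) [0..<m]"
  have chords: "arc_word (map Leg hs) = []" for hs
    by (induction hs) simp_all
  have hol: "holonomy (beaded_chords d m S) = ?hol S" for S
    by (auto simp: holonomy_def beaded_chords_def chords push_def)
  have inj: "?hol S = ?hol {..<m} \<longleftrightarrow> S = {..<m}" if "S \<in> Pow {..<m}" for S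
  proof -
    have "?hol S = ?hol {..<m} \<longleftrightarrow> (\<forall>i<m. i \<in> S)"
      by auto
    with that show ?thesis by auto
  qed
  have "Poly_Mapping.lookup (lin_ext weight (alternating_chords d m :: _ \<Rightarrow>\<^sub>0 'k)) (?hol {..<m})
      = (\<Sum>S\<in>Pow {..<m}. (- 1) ^ card S * (if S = {..<m} then 1 else 0))"
    unfolding lin_ext_alternating_chords lookup_sum
  proof (rule sum.cong)
    fix S assume "S \<in> Pow {..<m}"
    then show "Poly_Mapping.lookup (pm_scale ((- 1) ^ card S) (weight (beaded_chords d m S)))
        (?hol {..<m}) = (- 1) ^ card S * (if S = {..<m} then 1 else 0)"
      using inj[of S] by (auto simp: weight_def hol lookup_single when_def simp del: map_eq_conv)
  qed simp
  also have "\<dots> = (- 1) ^ m"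
    by (simp add: if_distrib[of "(*) _"] sum.delta cong: if_cong)
  finally show ?thesis
    by auto
qed

lemma not_polynomial_with_beads:
  assumes "0 < n"
  shows "\<not> polynomial_of_degree_le
    (jacobi_functor d n :: ('k::field, (diagram \<Rightarrow>\<^sub>0 'k) set) gr_op_functor) e"
proof
  let ?v = "alternating_chords d (Suc e) :: diagram \<Rightarrow>\<^sub>0 'k"
  assume "polynomial_of_degree_le
    (jacobi_functor d n :: ('k, (diagram \<Rightarrow>\<^sub>0 'k) set) gr_op_functor) e"
  moreover have "?v \<in> pm.span (basis_vec ` {D \<in> diagrams n (Suc e). has_degree D d})"
    unfolding alternating_chords_def using assms
    by (intro pm.span_sum pm.span_scale pm.span_base imageI)
       (simp add: beaded_chords_in_diagrams has_degree_beaded_chords)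
  moreover have "linear_action (face k) e ?v \<in> relations n e" if "k \<le> e" for k
    by (simp add: face_kills_alternating_chords[OF that] zero_in_relations)
  ultimately have "?v \<in> relations n (Suc e)"
    unfolding polynomial_of_degree_le_jacobi_functor_iff by blast
  then show False
    using weight_relations weight_alternating_chords by blast
qed

theorem proposition1:
  fixes d n :: nat
  shows "is_polynomial
           (jacobi_functor d n :: ('k::field_char_0, (diagram \<Rightarrow>\<^sub>0 'k) set) gr_op_functor)
         \<longleftrightarrow> n = 0"
  unfolding is_polynomial_def
  using polynomial_without_beads not_polynomial_with_beads by (metis gr0I)

end
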